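(* Let $\omega>0$, let $h:[0,+\infty)\to\mathbb{R}$ satisfy (P1), (P2), (P4), (P5) of the context, and for $\lambda\in(-1,+\infty)$ (P3) let $\varphi_\lambda$ be the flow of the impulsive problem with pulse parameter $\lambda$ described in the context. Put $R_\omega(x)=\varphi_0(\omega,x)$ and $$g(x)=\frac{x}{R_\omega(x)}-1,\qquad x>0 .$$ Then: 1. For every $\lambda>-1$, the number of $\omega$-periodic orbits of the impulsive problem varies with $\lambda$ and equals the number of intersection points, over $x\in[0,+\infty)$, of the graphs of $R_\omega$ and of $\ell(x)=\dfrac{x}{\lambda+1}$. 2. The values of $\lambda$ for which there are $\omega$-periodic solutions are given, as a function of the initial condition, by $\lambda=g(x)$: for $x>0$ and $\lambda>-1$, the solution $\varphi_\lambda(\cdot,x)$ is $\omega$-periodic if and only if $\lambda=g(x)$. 3. For each $x_0>0$ there exists $\lambda>-1$ for which the impulsive problem has an $\omega$-periodic solution with initial condition $x_0$. 4. Let $\lambda>-1$ and let $x_0>0$ be such that $\varphi_\lambda(\cdot,x_0)$ is $\omega$-periodic. (a) If $g'(x_0)>0$, then $\varphi_\lambda(t,x_0)$ is asymptotically stable. (b) If $g'(x_0)<0$, then $\varphi_\lambda(t,x_0)$ is unstable.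
   Context: Unperturbed problem: $\dot x=h(x)$, $x(0)=x_0\ge 0$, with flow $\varphi(t,x)=\varphi_0(t,x)$, $t\ge 0$, $x\in[0,+\infty)$. (P1) $h$ is $C^2$ and $h(x)=Ax+H(x)$, with $A=h'(0)$ and $H$ not identically zero, $H(x)=\mathcal{O}(x^2)$ as $x\to0$. It is assumed throughout that $A<0$. (P2) $h$ has finitely many zeros in $[0,+\infty)$, all hyperbolic ($h'\neq0$ there), and their number is odd, equal to $2n-1$ with $n\ge1$. They are ordered as $0=X_1^s<X_1^u<X_2^s<X_2^u<\dots<X_n^s$ ($s$ = stable, $h'(X_j^s)<0$; $u$ = unstable, $h'(X_j^u)>0$). (P3) $\lambda\in(-1,+\infty)$. Impulsive problem with parameter $\lambda$: with $T_k=k\omega$ for $k\in\mathbb{N}=\{1,2,\dots\}$, the solution $\varphi_\lambda(\cdot,x_0)$ satisfies $\varphi_\lambda(0,x_0)=x_0\ge0$, $\dot x=h(x)$ on each interval between consecutive times $0,T_1,T_2,\dots$, and at each pulse time $$\varphi_\lambda(T_k,x_0)=(1+\lambda)\lim_{t\to T_k^-}\varphi_\lambda(t,x_0).$$ (P4) For all $j\in\{1,\dots,n-1\}$, $R_\omega$ is convex on $(X_j^s,X_j^u)$ and concave on $(X_j^u,X_{j+1}^s)$. (P5) For all $j\in\{1,\dots,n-1\}$ there is a unique pair $(m_j,M_j)$ with $m_j,M_j\in[X_j^s,X_{j+1}^s]$ and $$\frac{R_\omega(m_j)}{m_j}=\min_{x\in[X_j^s,X_{j+1}^s]}\frac{R_\omega(x)}{x}=\beta_j<1,\qquad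 \frac{R_\omega(M_j)}{M_j}=\max_{x\in[X_j^s,X_{j+1}^s]}\frac{R_\omega(x)}{x}=\gamma_j>1,$$ where $R_\omega(x)/x$ is given the value $\exp(A\omega)$ at $x=0$. Periodicity: $\varphi_\lambda(\cdot,x_0)$ is $\omega$-periodic if $\varphi_\lambda(t+\omega,x_0)=\varphi_\lambda(t,x_0)$ for all $t\ge0$; constant solutions (such as the one at $x_0=0$) are counted here. Stability of an $\omega$-periodic solution $\varphi_\lambda(\cdot,x_0)$ (neighbourhoods taken in $[0,+\infty)$): it is stable if for every neighbourhood $V$ of $x_0$ there is a neighbourhood $W\subset V$ of $x_0$ such that $\varphi_\lambda(k\omega,y_0)\in V$ for all $y_0\in W$ and $k\in\mathbb{N}$; asymptotically stable if it is stable and there is a neighbourhood $V$ of $x_0$ such that $\lim_{k\to+\infty}\varphi_\lambda(k\omega,y_0)=x_0$ for all $y_0\in V$; unstable if it is not stable. *)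

theory Defs
  imports "HOL-Analysis.Analysis" "HOL-Library.Landau_Symbols" "HOL-Library.Equipollence"
begin

text \<open>A function on \<open>[0, \<infinity>)\<close> is represented by a total function whose values at negative
  arguments are irrelevant; derivatives at \<open>0\<close> are therefore one-sided.\<close>

definition C2_halfline :: "(real \<Rightarrow> real) \<Rightarrow> (real \<Rightarrow> real) \<Rightarrow> (real \<Rightarrow> real) \<Rightarrow> bool" where
  "C2_halfline h h' h'' \<longleftrightarrow>
     (\<forall>x\<ge>0. (h has_real_derivative h' x) (at x within {0..})) \<and>
     (\<forall>x\<ge>0. (h' has_real_derivative h'' x) (at x within {0..})) \<and>
     continuous_on {0..} h''"

definition P1 :: "(real \<Rightarrow> real) \<Rightarrow> (real \<Rightarrow> real) \<Rightarrow> (real \<Rightarrow> real) \<Rightarrow> bool" where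
  "P1 h h' h'' \<longleftrightarrow>
     C2_halfline h h' h'' \<and>
     (\<exists>x\<ge>0. h x - h' 0 * x \<noteq> 0) \<and>
     (\<lambda>x. h x - h' 0 * x) \<in> O[at 0 within {0..}](\<lambda>x. x^2) \<and>
     h' 0 < 0"

definition P2 :: "(real \<Rightarrow> real) \<Rightarrow> (real \<Rightarrow> real) \<Rightarrow> nat \<Rightarrow> (nat \<Rightarrow> real) \<Rightarrow> (nat \<Rightarrow> real) \<Rightarrow> bool" where
  "P2 h h' n Xs Xu \<longleftrightarrow>
     n \<ge> 1 \<and>
     {x. 0 \<le> x \<and> h x = 0} = Xs ` {1..n} \<union> Xu ` {1..<n} \<and>
     Xs 1 = 0 \<and>
     (\<forall>j\<in>{1..<n}. Xs j < Xu j \<and> Xu j < Xs (j + 1)) \<and>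
     (\<forall>j\<in>{1..n}. h' (Xs j) < 0) \<and>
     (\<forall>j\<in>{1..<n}. h' (Xu j) > 0)"

text \<open>The differential equation is imposed on each \<open>[k\<omega>, (k+1)\<omega>)\<close>, with a right derivative at
  \<open>k\<omega>\<close>; this makes the solution right-continuous at the pulse times. For \<open>\<lambda> = 0\<close> the pulse
  condition is just continuity, so the solution is that of the unperturbed problem.\<close>

definition impulsive_solution ::
    "(real \<Rightarrow> real) \<Rightarrow> real \<Rightarrow> real \<Rightarrow> real \<Rightarrow> (real \<Rightarrow> real) \<Rightarrow> bool" where
  "impulsive_solution h \<omega> lam x0 f \<longleftrightarrow>
     f 0 = x0 \<and>
     (\<forall>t\<ge>0. f t \<ge> 0) \<and>
     (\<forall>k::nat. \<forall>t\<in>{real k * \<omega>..<real (k + 1) * \<omega>}.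
        (f has_real_derivative h (f t)) (at t within {real k * \<omega>..<real (k + 1) * \<omega>})) \<and>
     (\<forall>k::nat. k \<ge> 1 \<longrightarrow>
        (\<exists>L. (f \<longlongrightarrow> L) (at_left (real k * \<omega>)) \<and> f (real k * \<omega>) = (1 + lam) * L))"

text \<open>\<open>phi lam t x\<close> stands for \<open>\<phi>\<^sub>\<lambda>(t, x)\<close>.\<close>

definition impulsive_flow ::
    "(real \<Rightarrow> real) \<Rightarrow> real \<Rightarrow> (real \<Rightarrow> real \<Rightarrow> real \<Rightarrow> real) \<Rightarrow> bool" where
  "impulsive_flow h \<omega> phi \<longleftrightarrow>
     (\<forall>lam>-1. \<forall>x\<ge>0. impulsive_solution h \<omega> lam x (\<lambda>t. phi lam t x))"

definition P4 :: "(real \<Rightarrow> real) \<Rightarrow> nat \<Rightarrow> (nat \<Rightarrow> real) \<Rightarrow> (nat \<Rightarrow> real) \<Rightarrow> bool" where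
  "P4 R n Xs Xu \<longleftrightarrow>
     (\<forall>j\<in>{1..<n}. convex_on {Xs j<..<Xu j} R \<and> concave_on {Xu j<..<Xs (j + 1)} R)"

definition ratio :: "(real \<Rightarrow> real) \<Rightarrow> real \<Rightarrow> real \<Rightarrow> real \<Rightarrow> real" where
  "ratio R A \<omega> x = (if x = 0 then exp (A * \<omega>) else R x / x)"

definition P5 :: "(real \<Rightarrow> real) \<Rightarrow> real \<Rightarrow> real \<Rightarrow> nat \<Rightarrow> (nat \<Rightarrow> real) \<Rightarrow> bool" where
  "P5 R A \<omega> n Xs \<longleftrightarrow>
     (\<forall>j\<in>{1..<n}. \<exists>!(m, M).
        m \<in> {Xs j..Xs (j + 1)} \<and> M \<in> {Xs j..Xs (j + 1)} \<and>
        (\<forall>x\<in>{Xs j..Xs (j + 1)}. ratio R A \<omega> m \<le> ratio R A \<omega> x) \<and> ratio R A \<omega> m < 1 \<and>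
        (\<forall>x\<in>{Xs j..Xs (j + 1)}. ratio R A \<omega> x \<le> ratio R A \<omega> M) \<and> ratio R A \<omega> M > 1)"

definition is_periodic :: "real \<Rightarrow> (real \<Rightarrow> real) \<Rightarrow> bool" where
  "is_periodic \<omega> f \<longleftrightarrow> (\<forall>t\<ge>0. f (t + \<omega>) = f t)"

definition periodic_orbits :: "real \<Rightarrow> (real \<Rightarrow> real \<Rightarrow> real) \<Rightarrow> real set set" where
  "periodic_orbits \<omega> psi = {(\<lambda>t. psi t x) ` {0..} | x. 0 \<le> x \<and> is_periodic \<omega> (\<lambda>t. psi t x)}"

definition graph_halfline :: "(real \<Rightarrow> real) \<Rightarrow> (real \<times> real) set" where
  "graph_halfline f = {(x, f x) | x. 0 \<le> x}"

definition neighbourhood :: "real \<Rightarrow> real set \<Rightarrow> bool" where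
  "neighbourhood x V \<longleftrightarrow>
     V \<subseteq> {0..} \<and> (\<exists>U. openin (top_of_set {0..}) U \<and> x \<in> U \<and> U \<subseteq> V)"

definition stable_solution :: "real \<Rightarrow> (real \<Rightarrow> real \<Rightarrow> real) \<Rightarrow> real \<Rightarrow> bool" where
  "stable_solution \<omega> psi x0 \<longleftrightarrow>
     (\<forall>V. neighbourhood x0 V \<longrightarrow>
        (\<exists>W. neighbourhood x0 W \<and> W \<subseteq> V \<and>
           (\<forall>y\<in>W. \<forall>k::nat. k \<ge> 1 \<longrightarrow> psi (real k * \<omega>) y \<in> V)))"

definition asymptotically_stable_solution :: "real \<Rightarrow> (real \<Rightarrow> real \<Rightarrow> real) \<Rightarrow> real \<Rightarrow> bool" where
  "asymptotically_stable_solution \<omega> psi x0 \<longleftrightarrow>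
     stable_solution \<omega> psi x0 \<and>
     (\<exists>V. neighbourhood x0 V \<and> (\<forall>y\<in>V. (\<lambda>k::nat. psi (real k * \<omega>) y) \<longlonglongrightarrow> x0))"

definition unstable_solution :: "real \<Rightarrow> (real \<Rightarrow> real \<Rightarrow> real) \<Rightarrow> real \<Rightarrow> bool" where
  "unstable_solution \<omega> psi x0 \<longleftrightarrow> \<not> stable_solution \<omega> psi x0"

end

theory Submission
  imports Defs
begin

text \<open>Write \<open>P\<^sub>\<lambda> = (1 + \<lambda>) R\<close>. The stroboscopic values of a solution of the impulsive problem are
  the iterates of \<open>P\<^sub>\<lambda>\<close>, and on every period the solution follows the unperturbed flow. Hence
  periodic solutions are the fixed points of \<open>P\<^sub>\<lambda>\<close>, that is, the solutions of
  \<open>R x = x / (1 + \<lambda>)\<close>, or, for \<open>x > 0\<close>, of \<open>\<lambda> = g x\<close>. Unperturbed solutions are monotone, so a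
  periodic orbit has its initial point as its largest element when \<open>\<lambda> \<ge> 0\<close> and as its smallest
  when \<open>\<lambda> \<le> 0\<close>; distinct fixed points therefore have distinct orbits.

  The number of orbits is not constant. The field \<open>h\<close> is negative to the right of its last zero, so
  \<open>h x \<le> C x\<close> for some \<open>C\<close> and \<open>R x \<le> exp (C \<omega>) x\<close>. For \<open>\<lambda>\<close> near \<open>-1\<close> the line
  \<open>x / (1 + \<lambda>)\<close> is steeper than that, and only \<open>0\<close> is periodic, while for \<open>\<lambda> = g 1\<close> both
  \<open>0\<close> and \<open>1\<close> are.

  For stability, \<open>R\<close> is strictly increasing (uniqueness for the equation) and differentiable on
  \<open>(0, \<infinity>)\<close> (the difference quotient \<open>D\<close> of two solutions satisfies
  \<open>(ln D)' = (h v - h u) / (v - u)\<close>, which tends to \<open>h' u\<close>). Since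
  \<open>P\<^sub>\<lambda> x / x = (1 + \<lambda>) / (1 + g x)\<close>, the sign of \<open>g x - \<lambda>\<close> tells on which side of
  \<open>x\<close> the point \<open>P\<^sub>\<lambda> x\<close> lies. If \<open>g' x\<^sub>0 > 0\<close>, iterates move monotonically towards \<open>x\<^sub>0\<close>, and
  their limit is a fixed point, hence \<open>x\<^sub>0\<close>. If \<open>g' x\<^sub>0 < 0\<close>, iterates starting slightly to the
  right of \<open>x\<^sub>0\<close> increase and, having no fixed point to converge to, leave a fixed neighbourhood.\<close>

section \<open>Functions on the half-line and monotone iteration\<close>

lemma lipschitz_of_continuous_derivative:
  fixes f f' :: "real \<Rightarrow> real"
  assumes der: "\<And>x. x \<ge> 0 \<Longrightarrow> (f has_real_derivative f' x) (at x within {0..})"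
    and cont: "continuous_on {0..} f'"
  shows "\<exists>K\<ge>0. \<forall>x\<in>{0..B}. \<forall>y\<in>{0..B}. \<bar>f y - f x\<bar> \<le> K * \<bar>y - x\<bar>"
proof -
  have "compact (f' ` {0..B})"
    by (intro compact_continuous_image continuous_on_subset[OF cont]) auto
  then obtain K where K: "\<And>x. x \<in> {0..B} \<Longrightarrow> \<bar>f' x\<bar> \<le> K"
    using compact_imp_bounded[of "f' ` {0..B}"] unfolding bounded_iff by (metis imageI real_norm_def)
  have "norm (f y - f x) \<le> max K 0 * norm (y - x)" if "x \<in> {0..B}" "y \<in> {0..B}" for x y
  proof (rule field_differentiable_bound[where S = "{0..B}" and f' = f'])
    show "(f has_field_derivative f' z) (at z within {0..B})" if "z \<in> {0..B}" for z
      using der[of z] that by (auto intro: DERIV_subset)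
    show "norm (f' z) \<le> max K 0" if "z \<in> {0..B}" for z
      using K[OF that] by auto
  qed (use that in auto)
  then show ?thesis
    by (intro exI[of _ "max K 0"]) auto
qed

lemma monotone_orbit_converges_to_fixed_point:
  fixes P :: "real \<Rightarrow> real"
  assumes mono: "monoseq z" and range: "\<And>k. z k \<in> {a..b}"
    and step: "\<And>k. z (Suc k) = P (z k)" and cont: "continuous_on {a..b} P"
  shows "\<exists>l\<in>{a..b}. z \<longlonglongrightarrow> l \<and> P l = l"
proof -
  have "\<bar>z k\<bar> \<le> max \<bar>a\<bar> \<bar>b\<bar>" for k
    using range[of k] by auto
  then have "Bseq z"
    by (intro BseqI'[of _ "max \<bar>a\<bar> \<bar>b\<bar>"]) simp
  then obtain l where l: "z \<longlonglongrightarrow> l"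
    using Bseq_monoseq_convergent[OF _ mono] by (auto simp: convergent_def)
  have "l \<in> {a..b}"
    using closed_sequentially[OF closed_atLeastAtMost _ l] range by auto
  then have "(\<lambda>k. P (z k)) \<longlonglongrightarrow> P l"
    by (intro continuous_on_tendsto_compose[OF cont l]) (use \<open>l \<in> {a..b}\<close> range in auto)
  moreover have "(\<lambda>k. P (z k)) \<longlonglongrightarrow> l"
    using LIMSEQ_Suc[OF l] by (simp add: step)
  ultimately show ?thesis
    using \<open>l \<in> {a..b}\<close> l LIMSEQ_unique by blast
qed

lemma monotone_map_attracts:
  fixes P :: "real \<Rightarrow> real"
  assumes mono: "mono_on {a..b} P" and cont: "continuous_on {a..b} P"
    and fixed: "P c = c" and c: "c \<in> {a..b}"
    and right: "\<And>x. c < x \<Longrightarrow> x \<le> b \<Longrightarrow> P x < x"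
    and left: "\<And>x. a \<le> x \<Longrightarrow> x < c \<Longrightarrow> x < P x"
    and z0: "z 0 \<in> {a..b}" and step: "\<And>k. z (Suc k) = P (z k)"
  shows "z \<longlonglongrightarrow> c \<and> (\<forall>k. \<bar>z k - c\<bar> \<le> \<bar>z 0 - c\<bar>)"
proof -
  have unique: "l = c" if "l \<in> {a..b}" "P l = l" for l
    using right[of l] left[of l] that by (cases l c rule: linorder_cases) auto
  show ?thesis
  proof (cases "c \<le> z 0")
    case True
    have range: "z k \<in> {c..z 0}" for k
    proof (induction k)
      case (Suc k)
      have "P c \<le> P (z k)"
        using mono_onD[OF mono c, of "z k"] Suc z0 c by auto
      moreover have "P (z k) \<le> z k"
        using right[of "z k"] fixed Suc z0 by (cases "z k = c") auto
      ultimately show ?case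
        using Suc by (simp add: step fixed)
    qed (use True in auto)
    have "z (Suc k) \<le> z k" for k
      using right[of "z k"] fixed range[of k] z0 by (cases "z k = c") (auto simp: step)
    then have "monoseq z"
      by (simp add: monoseq_Suc)
    then obtain l where "l \<in> {a..b}" "z \<longlonglongrightarrow> l" "P l = l"
      using monotone_orbit_converges_to_fixed_point[of z a b P] range z0 c step cont
      by (metis atLeastAtMost_iff order_trans)
    then show ?thesis
      using unique range by fastforce
  next
    case False
    have range: "z k \<in> {z 0..c}" for k
    proof (induction k)
      case (Suc k)
      have "P (z k) \<le> P c"
        using mono_onD[OF mono _ c, of "z k"] Suc z0 c by auto
      moreover have "z k \<le> P (z k)"
        using left[of "z k"] fixed Suc z0 by (cases "z k = c") auto
      ultimately show ?case
        using Suc by (simp add: step fixed)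
    qed (use False in auto)
    have "z k \<le> z (Suc k)" for k
      using left[of "z k"] fixed range[of k] z0 by (cases "z k = c") (auto simp: step)
    then have "monoseq z"
      by (simp add: monoseq_Suc)
    then obtain l where "l \<in> {a..b}" "z \<longlonglongrightarrow> l" "P l = l"
      using monotone_orbit_converges_to_fixed_point[of z a b P] range z0 c step cont
      by (metis atLeastAtMost_iff order_trans)
    then show ?thesis
      using unique range by fastforce
  qed
qed

lemma neighbourhood_contains_interval:
  assumes "neighbourhood x V" "x > 0"
  obtains d where "0 < d" "d < x" "{x - d..x + d} \<subseteq> V"
proof -
  obtain U where U: "openin (top_of_set {0..}) U" "x \<in> U" "U \<subseteq> V"
    using assms by (auto simp: neighbourhood_def)
  obtain e where e: "e > 0" "cball x e \<inter> {0..} \<subseteq> U"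
    using U by (auto simp: openin_contains_cball)
  have "{x - min e (x/2)..x + min e (x/2)} \<subseteq> cball x e \<inter> {0..}"
    using assms(2) by (auto simp: dist_real_def)
  then show ?thesis
    using e U assms(2) by (intro that[of "min e (x/2)"]) auto
qed

lemma neighbourhood_interval:
  assumes "0 < d" "d \<le> x"
  shows "neighbourhood x {x - d<..<x + d}"
proof -
  have "openin (top_of_set {0..}) {x - d<..<x + d}"
    using assms by (intro open_subset) auto
  then show ?thesis
    using assms unfolding neighbourhood_def
    by (intro conjI exI[of _ "{x - d<..<x + d}"]) auto
qed

section \<open>Solutions of the unperturbed equation\<close>

text \<open>A nonnegative solution of \<open>u' = h u\<close> on \<open>[0, T]\<close>: the equation is required in the interior only
  and continuity up to the endpoints, so the value at \<open>T\<close> is the left limit there. This makes the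
  notion applicable to one period of an impulsive solution, before the pulse.\<close>

definition solution_on :: "(real \<Rightarrow> real) \<Rightarrow> real \<Rightarrow> (real \<Rightarrow> real) \<Rightarrow> bool" where
  "solution_on h T u \<longleftrightarrow>
     continuous_on {0..T} u \<and> (\<forall>t\<in>{0..T}. 0 \<le> u t) \<and>
     (\<forall>t\<in>{0<..<T}. (u has_real_derivative h (u t)) (at t))"

lemma solution_onD:
  assumes "solution_on h T u"
  shows "continuous_on {0..T} u" "\<And>t. 0 \<le> t \<Longrightarrow> t \<le> T \<Longrightarrow> 0 \<le> u t"
    "\<And>t. 0 < t \<Longrightarrow> t < T \<Longrightarrow> (u has_real_derivative h (u t)) (at t)"
  using assms by (auto simp: solution_on_def)

lemma solution_on_const: "h c = 0 \<Longrightarrow> c \<ge> 0 \<Longrightarrow> solution_on h T (\<lambda>_. c)"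
  by (auto simp: solution_on_def)

lemma solution_on_subset: "solution_on h T u \<Longrightarrow> S \<le> T \<Longrightarrow> solution_on h S u"
  by (auto simp: solution_on_def intro: continuous_on_subset)

text \<open>Gronwall's inequality in both directions of time, for functions \<open>w\<close> with \<open>\<bar>w'\<bar> \<le> c w\<close>.\<close>

lemma gronwall_two_sided:
  fixes w w' :: "real \<Rightarrow> real"
  assumes cont: "continuous_on {0..T} w" and t: "0 \<le> t" "t \<le> T"
    and der: "\<And>s. 0 < s \<Longrightarrow> s < T \<Longrightarrow> (w has_real_derivative w' s) (at s)"
    and bound: "\<And>s. 0 < s \<Longrightarrow> s < T \<Longrightarrow> \<bar>w' s\<bar> \<le> c * w s"
  shows "w t \<le> exp (c * t) * w 0" and "w 0 \<le> exp (c * t) * w t"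
proof -
  have cont': "continuous_on {0..t} w"
    using cont t by (auto intro: continuous_on_subset)
  have "w t * exp (- c * t) \<le> w 0 * exp (- c * 0)"
  proof (rule DERIV_nonpos_imp_decreasing_open[OF t(1)])
    fix s assume s: "0 < s" "s < t"
    have "((\<lambda>s. w s * exp (- c * s)) has_real_derivative
        w' s * exp (- c * s) + (exp (- c * s) * (- c)) * w s) (at s)"
      by (rule derivative_eq_intros der refl | use s t in simp)+
    moreover have "(w' s - c * w s) * exp (- c * s) \<le> 0"
      using bound[of s] s t by (intro mult_nonpos_nonneg) auto
    ultimately show "\<exists>y. ((\<lambda>s. w s * exp (- c * s)) has_real_derivative y) (at s) \<and> y \<le> 0"
      by (auto simp: algebra_simps)
  qed (intro continuous_intros cont')
  then show "w t \<le> exp (c * t) * w 0"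
    by (simp add: exp_minus field_simps)
  have "w 0 * exp (c * 0) \<le> w t * exp (c * t)"
  proof (rule DERIV_nonneg_imp_increasing_open[OF t(1)])
    fix s assume s: "0 < s" "s < t"
    have "((\<lambda>s. w s * exp (c * s)) has_real_derivative
        w' s * exp (c * s) + (exp (c * s) * c) * w s) (at s)"
      by (rule derivative_eq_intros der refl | use s t in simp)+
    moreover have "0 \<le> (w' s + c * w s) * exp (c * s)"
      using bound[of s] s t by (intro mult_nonneg_nonneg) auto
    ultimately show "\<exists>y. ((\<lambda>s. w s * exp (c * s)) has_real_derivative y) (at s) \<and> y \<ge> 0"
      by (auto simp: algebra_simps)
  qed (intro continuous_intros cont')
  then show "w 0 \<le> exp (c * t) * w t"
    by (simp add: algebra_simps)
qed

lemma solutions_separation: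
  assumes u: "solution_on h T u" and v: "solution_on h T v"
    and lip: "\<And>x y. x \<in> {0..B} \<Longrightarrow> y \<in> {0..B} \<Longrightarrow> \<bar>h y - h x\<bar> \<le> K * \<bar>y - x\<bar>"
    and bu: "\<And>t. t \<in> {0..T} \<Longrightarrow> u t \<le> B" and bv: "\<And>t. t \<in> {0..T} \<Longrightarrow> v t \<le> B"
    and t: "0 \<le> t" "t \<le> T"
  shows "\<bar>v t - u t\<bar> \<le> exp (K * t) * \<bar>v 0 - u 0\<bar>"
    and "\<bar>v 0 - u 0\<bar> \<le> exp (K * t) * \<bar>v t - u t\<bar>"
proof -
  define w where "w s = (v s - u s)\<^sup>2" for s
  define w' where "w' s = 2 * (v s - u s) * (h (v s) - h (u s))" for s
  have cont: "continuous_on {0..T} w"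
    unfolding w_def by (intro continuous_intros solution_onD(1)[OF u] solution_onD(1)[OF v])
  have der: "(w has_real_derivative w' s) (at s)" if "0 < s" "s < T" for s
    unfolding w_def w'_def
    by (rule derivative_eq_intros solution_onD(3)[OF u that] solution_onD(3)[OF v that] refl | simp)+
  have bound: "\<bar>w' s\<bar> \<le> (2 * K) * w s" if "0 < s" "s < T" for s
  proof -
    have "\<bar>h (v s) - h (u s)\<bar> \<le> K * \<bar>v s - u s\<bar>"
      using that solution_onD(2)[OF u] solution_onD(2)[OF v] bu bv by (intro lip) auto
    then have "2 * \<bar>v s - u s\<bar> * \<bar>h (v s) - h (u s)\<bar> \<le> 2 * \<bar>v s - u s\<bar> * (K * \<bar>v s - u s\<bar>)"
      by (intro mult_left_mono) auto
    also have "\<dots> = (2 * K) * (\<bar>v s - u s\<bar> * \<bar>v s - u s\<bar>)"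
      by (simp only: mult_ac)
    also have "\<dots> = (2 * K) * w s"
      by (simp add: w_def power2_eq_square)
    also have "2 * \<bar>v s - u s\<bar> * \<bar>h (v s) - h (u s)\<bar> = \<bar>w' s\<bar>"
      by (simp only: w'_def abs_mult abs_numeral)
    finally show ?thesis .
  qed
  have sq: "exp (2 * K * t) = (exp (K * t))\<^sup>2"
    by (simp add: power2_eq_square flip: exp_add)
  have "(v t - u t)\<^sup>2 \<le> (exp (K * t) * (v 0 - u 0))\<^sup>2"
    using gronwall_two_sided(1)[OF cont t der bound] sq by (simp add: w_def power_mult_distrib)
  then show "\<bar>v t - u t\<bar> \<le> exp (K * t) * \<bar>v 0 - u 0\<bar>"
    by (simp add: abs_le_square_iff[symmetric] abs_mult)
  have "(v 0 - u 0)\<^sup>2 \<le> (exp (K * t) * (v t - u t))\<^sup>2"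
    using gronwall_two_sided(2)[OF cont t der bound] sq by (simp add: w_def power_mult_distrib)
  then show "\<bar>v 0 - u 0\<bar> \<le> exp (K * t) * \<bar>v t - u t\<bar>"
    by (simp add: abs_le_square_iff[symmetric] abs_mult)
qed

text \<open>The linear bound \<open>h x \<le> C x\<close> keeps all solutions that start in a bounded set in a common
  bounded set, on which \<open>h\<close> and \<open>h'\<close> are Lipschitz.\<close>

locale halfline_field =
  fixes h h' h'' :: "real \<Rightarrow> real" and C :: real
  assumes C2: "C2_halfline h h' h''"
    and h0: "h 0 = 0"
    and C_nonneg: "C \<ge> 0"
    and linear_bound: "\<And>x. x \<ge> 0 \<Longrightarrow> h x \<le> C * x"
begin

lemma h_deriv: "x \<ge> 0 \<Longrightarrow> (h has_real_derivative h' x) (at x within {0..})"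
  and h'_deriv: "x \<ge> 0 \<Longrightarrow> (h' has_real_derivative h'' x) (at x within {0..})"
  and h''_cont: "continuous_on {0..} h''"
  using C2 by (auto simp: C2_halfline_def)

lemma h_cont: "continuous_on {0..} h"
  using h_deriv by (auto intro: DERIV_continuous_on)

lemma h'_cont: "continuous_on {0..} h'"
  using h'_deriv by (auto intro: DERIV_continuous_on)

lemma solution_bound:
  assumes u: "solution_on h T u" and t: "0 \<le> t" "t \<le> T"
  shows "u t \<le> exp (C * t) * u 0"
proof -
  have "u t * exp (- C * t) \<le> u 0 * exp (- C * 0)"
  proof (rule DERIV_nonpos_imp_decreasing_open[OF t(1)])
    fix s assume s: "0 < s" "s < t"
    have "((\<lambda>s. u s * exp (- C * s)) has_real_derivative
        h (u s) * exp (- C * s) + (exp (- C * s) * (- C)) * u s) (at s)"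
      by (rule derivative_eq_intros solution_onD(3)[OF u] refl | use s t in simp)+
    moreover have "(h (u s) - C * u s) * exp (- C * s) \<le> 0"
      using linear_bound[of "u s"] solution_onD(2)[OF u, of s] s t
      by (intro mult_nonpos_nonneg) auto
    ultimately show "\<exists>y. ((\<lambda>s. u s * exp (- C * s)) has_real_derivative y) (at s) \<and> y \<le> 0"
      by (auto simp: algebra_simps)
  next
    show "continuous_on {0..t} (\<lambda>s. u s * exp (- C * s))"
      using t by (intro continuous_intros continuous_on_subset[OF solution_onD(1)[OF u]]) auto
  qed
  then show ?thesis
    by (simp add: exp_minus field_simps)
qed

lemma solution_bound_uniform:
  assumes u: "solution_on h T u" and t: "t \<in> {0..T}" and b: "u 0 \<le> b"
  shows "u t \<le> exp (C * T) * b"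
proof -
  have "u t \<le> exp (C * t) * u 0"
    using solution_bound[OF u] t by auto
  also have "\<dots> \<le> exp (C * T) * b"
    using t b C_nonneg solution_onD(2)[OF u, of 0]
    by (intro mult_mono) (auto intro: mult_left_mono)
  finally show ?thesis .
qed

text \<open>Two solutions that start at most at \<open>b\<close> approach or leave each other at most exponentially,
  with a rate depending only on \<open>b\<close> and \<open>T\<close>.\<close>

lemma uniform_separation:
  obtains K where "K \<ge> 0"
    "\<And>u v t. solution_on h T u \<Longrightarrow> solution_on h T v \<Longrightarrow> u 0 \<le> b \<Longrightarrow> v 0 \<le> b \<Longrightarrow> 0 \<le> t \<Longrightarrow> t \<le> T \<Longrightarrow>
       \<bar>v t - u t\<bar> \<le> exp (K * t) * \<bar>v 0 - u 0\<bar> \<and> \<bar>v 0 - u 0\<bar> \<le> exp (K * t) * \<bar>v t - u t\<bar>"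
proof -
  define B where "B = exp (C * T) * b"
  obtain K where K: "K \<ge> 0" "\<forall>x\<in>{0..B}. \<forall>y\<in>{0..B}. \<bar>h y - h x\<bar> \<le> K * \<bar>y - x\<bar>"
    using lipschitz_of_continuous_derivative[OF h_deriv h'_cont, of B] by auto
  have "\<bar>v t - u t\<bar> \<le> exp (K * t) * \<bar>v 0 - u 0\<bar> \<and> \<bar>v 0 - u 0\<bar> \<le> exp (K * t) * \<bar>v t - u t\<bar>"
    if "solution_on h T u" "solution_on h T v" "u 0 \<le> b" "v 0 \<le> b" "0 \<le> t" "t \<le> T" for u v t
    using solutions_separation[where B = B and K = K, OF that(1,2) _ _ _ that(5,6)]
      solution_bound_uniform[OF that(1) _ that(3)] solution_bound_uniform[OF that(2) _ that(4)] K(2)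
    unfolding B_def by blast
  then show ?thesis
    using that K(1) by blast
qed

lemma solution_meets_iff:
  assumes "solution_on h T u" "solution_on h T v" "0 \<le> t" "t \<le> T"
  shows "u t = v t \<longleftrightarrow> u 0 = v 0"
proof -
  obtain K where "\<bar>v t - u t\<bar> \<le> exp (K * t) * \<bar>v 0 - u 0\<bar>"
      "\<bar>v 0 - u 0\<bar> \<le> exp (K * t) * \<bar>v t - u t\<bar>"
    using uniform_separation[of T "max (u 0) (v 0)"] assms by (metis max.cobounded1 max.cobounded2)
  then show ?thesis
    by auto
qed

lemma solution_order:
  assumes u: "solution_on h T u" and v: "solution_on h T v" and t: "0 \<le> t" "t \<le> T"
    and less: "u 0 < v 0"
  shows "u t < v t"
proof (rule ccontr)
  assume "\<not> u t < v t"
  then have "\<exists>s. 0 \<le> s \<and> s \<le> t \<and> v s - u s = 0"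
    using t less
    by (intro IVT2' continuous_intros continuous_on_subset[OF solution_onD(1)[OF u]]
        continuous_on_subset[OF solution_onD(1)[OF v]]) auto
  then obtain s where "0 \<le> s" "s \<le> t" "v s - u s = 0"
    by auto
  then show False
    using solution_meets_iff[OF u v, of s] t less by auto
qed

text \<open>A nonconstant solution never meets a zero of \<open>h\<close>, so \<open>h\<close> keeps its sign along it and the
  solution is monotone.\<close>

lemma solution_no_zero:
  assumes u: "solution_on h T u" and t: "0 \<le> t" "t \<le> T" and nz: "h (u 0) \<noteq> 0"
  shows "h (u t) \<noteq> 0"
proof
  assume "h (u t) = 0"
  then have "solution_on h T (\<lambda>_. u t)"
    using solution_onD(2)[OF u] t by (intro solution_on_const) auto
  then have "u 0 = u t"
    using solution_meets_iff[OF u _ t] by auto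
  then show False
    using nz \<open>h (u t) = 0\<close> by simp
qed

lemma h_along_solution_cont:
  assumes u: "solution_on h T u" and "t \<le> T"
  shows "continuous_on {0..t} (\<lambda>s. h (u s))"
proof (rule continuous_on_compose2[OF h_cont])
  show "continuous_on {0..t} u"
    using assms by (auto intro: continuous_on_subset[OF solution_onD(1)[OF u]])
  show "u ` {0..t} \<subseteq> {0..}"
    using solution_onD(2)[OF u] assms by auto
qed

lemma solution_increasing:
  assumes u: "solution_on h T u" and t: "0 < t" "t \<le> T" and pos: "h (u 0) > 0"
  shows "u 0 < u t"
proof -
  have "h (u s) > 0" if s: "0 \<le> s" "s \<le> T" for s
  proof (rule ccontr)
    assume "\<not> h (u s) > 0"
    then have "\<exists>r. 0 \<le> r \<and> r \<le> s \<and> h (u r) = 0"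
      using pos s h_along_solution_cont[OF u] by (intro IVT2') auto
    then show False
      using solution_no_zero[OF u] pos s by fastforce
  qed
  then show ?thesis
    using t solution_onD(3)[OF u]
    by (intro DERIV_pos_imp_increasing_open[OF t(1)] continuous_on_subset[OF solution_onD(1)[OF u]])
      fastforce+
qed

lemma solution_decreasing:
  assumes u: "solution_on h T u" and t: "0 < t" "t \<le> T" and neg: "h (u 0) < 0"
  shows "u t < u 0"
proof -
  have "h (u s) < 0" if s: "0 \<le> s" "s \<le> T" for s
  proof (rule ccontr)
    assume "\<not> h (u s) < 0"
    then have "\<exists>r. 0 \<le> r \<and> r \<le> s \<and> h (u r) = 0"
      using neg s h_along_solution_cont[OF u] by (intro IVT') auto
    then show False
      using solution_no_zero[OF u] neg s by fastforce
  qed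
  then show ?thesis
    using t solution_onD(3)[OF u]
    by (intro DERIV_neg_imp_decreasing_open[OF t(1)] continuous_on_subset[OF solution_onD(1)[OF u]])
      fastforce+
qed

lemma solution_stationary:
  assumes u: "solution_on h T u" and t: "0 \<le> t" "t \<le> T" and zero: "h (u 0) = 0"
  shows "u t = u 0"
proof -
  have "solution_on h T (\<lambda>_. u 0)"
    using solution_onD(2)[OF u] t zero by (intro solution_on_const) auto
  from solution_meets_iff[OF u this t] show ?thesis
    by simp
qed

lemma solution_stays_below:
  assumes u: "solution_on h T u" and "T > 0" and final: "u T \<le> u 0" and t: "0 \<le> t" "t \<le> T"
  shows "u t \<le> u 0"
proof -
  have "h (u 0) \<le> 0"
    using solution_increasing[OF u \<open>T > 0\<close>] final by fastforce
  then show ?thesis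
    using solution_decreasing[OF u, of t] solution_stationary[OF u t] t
    by (cases "t = 0"; cases "h (u 0) = 0") auto
qed

lemma solution_stays_above:
  assumes u: "solution_on h T u" and "T > 0" and final: "u 0 \<le> u T" and t: "0 \<le> t" "t \<le> T"
  shows "u 0 \<le> u t"
proof -
  have "0 \<le> h (u 0)"
    using solution_decreasing[OF u \<open>T > 0\<close>] final by fastforce
  then show ?thesis
    using solution_increasing[OF u, of t] solution_stationary[OF u t] t
    by (cases "t = 0"; cases "h (u 0) = 0") auto
qed

text \<open>Differentiability with respect to the initial value. With \<open>A\<close> a primitive of \<open>h' \<circ> u\<close>, where
  \<open>u\<close> starts at \<open>x\<close>, and \<open>D\<close> the difference quotient of a solution \<open>v\<close> and \<open>u\<close>, the function
  \<open>ln D - A\<close> vanishes at time \<open>0\<close> and its derivative is at most of the order of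
  \<open>\<bar>v 0 - x\<bar>\<close> because \<open>h'\<close> is locally Lipschitz. The derivative at \<open>x\<close> is \<open>exp (A T)\<close>.\<close>

lemma differentiable_in_initial_value:
  assumes F: "\<And>y. y \<ge> 0 \<Longrightarrow> solution_on h T (\<lambda>t. F t y) \<and> F 0 y = y"
    and T: "T > 0" and x: "x > 0"
  shows "\<exists>r. ((\<lambda>y. F T y) has_real_derivative r) (at x)"
proof -
  define u where "u = (\<lambda>t. F t x)"
  have u: "solution_on h T u" and u0: "u 0 = x"
    using F[of x] x by (auto simp: u_def)
  define B where "B = exp (C * T) * (x + 1)"
  have bound: "F t y \<in> {0..B}" if "0 \<le> y" "y \<le> x + 1" "t \<in> {0..T}" for t y
    using F[OF that(1)] solution_bound_uniform[of T "\<lambda>t. F t y" t "x + 1"] that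
      solution_onD(2)[of h T "\<lambda>t. F t y" t] by (auto simp: B_def)
  obtain K where K: "K \<ge> 0" "\<And>u v t. solution_on h T u \<Longrightarrow> solution_on h T v \<Longrightarrow>
      u 0 \<le> x + 1 \<Longrightarrow> v 0 \<le> x + 1 \<Longrightarrow> 0 \<le> t \<Longrightarrow> t \<le> T \<Longrightarrow>
      \<bar>v t - u t\<bar> \<le> exp (K * t) * \<bar>v 0 - u 0\<bar> \<and> \<bar>v 0 - u 0\<bar> \<le> exp (K * t) * \<bar>v t - u t\<bar>"
    using uniform_separation[of T "x + 1"] by metis
  obtain M where M: "M \<ge> 0" "\<forall>x\<in>{0..B}. \<forall>y\<in>{0..B}. \<bar>h' y - h' x\<bar> \<le> M * \<bar>y - x\<bar>"
    using lipschitz_of_continuous_derivative[OF h'_deriv h''_cont, of B] by auto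
  have h'u_cont: "continuous_on {0..T} (\<lambda>t. h' (u t))"
    using solution_onD[OF u] by (intro continuous_on_compose2[OF h'_cont]) auto
  define A where "A t = integral {0..t} (\<lambda>t. h' (u t))" for t
  have A_within: "(A has_real_derivative h' (u t)) (at t within {0..T})" if "t \<in> {0..T}" for t
    unfolding A_def using integral_has_real_derivative[OF h'u_cont that] .
  have A_der: "(A has_real_derivative h' (u t)) (at t)" if "0 < t" "t < T" for t
    using A_within[of t] that at_within_Icc_at[of 0 t T] by simp
  have A_cont: "continuous_on {0..T} A"
    by (rule DERIV_continuous_on[OF A_within])
  have A0: "A 0 = 0"
    by (simp add: A_def)
  define q where "q y = (F T y - F T x) / (y - x)" for y
  define c where "c = M * exp (K * T) * T"
  have main: "q y > 0 \<and> \<bar>ln (q y) - A T\<bar> \<le> c * \<bar>y - x\<bar>"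
    if y: "0 \<le> y" "y \<le> x + 1" "y \<noteq> x" for y
  proof -
    define v where "v = (\<lambda>t. F t y)"
    have v: "solution_on h T v" and v0: "v 0 = y"
      using F[OF y(1)] by (auto simp: v_def)
    define D where "D t = (v t - u t) / (y - x)" for t
    have D_pos: "D t > 0" if "0 \<le> t" "t \<le> T" for t
      using solution_order[OF u v that] solution_order[OF v u that] y(3)
      by (cases "x < y") (auto simp: D_def u0 v0 divide_neg_neg)
    then have vu: "v t - u t \<noteq> 0" if "0 \<le> t" "t \<le> T" for t
      using that by (fastforce simp: D_def)
    define E where "E t = ln (D t) - A t" for t
    have D_cont: "continuous_on {0..T} D"
      unfolding D_def using y(3)
      by (intro continuous_intros solution_onD(1)[OF u] solution_onD(1)[OF v]) auto
    have E_cont: "continuous_on {0..T} E"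
      unfolding E_def using D_pos by (intro continuous_intros D_cont A_cont) fastforce
    have E_der: "(E has_real_derivative (h (v t) - h (u t)) / (v t - u t) - h' (u t)) (at t)"
      if t: "0 < t" "t < T" for t
    proof -
      have "(D has_real_derivative (h (v t) - h (u t)) / (y - x)) (at t)"
        unfolding D_def
        by (intro DERIV_cdivide DERIV_diff solution_onD(3)[OF u t] solution_onD(3)[OF v t])
      then have "(E has_real_derivative
          inverse (D t) * ((h (v t) - h (u t)) / (y - x)) - h' (u t)) (at t)"
        unfolding E_def using t D_pos[of t]
        by (intro DERIV_diff A_der DERIV_chain2[OF DERIV_ln]) auto
      then show ?thesis
        using vu[of t] t y(3) by (simp add: D_def)
    qed
    obtain \<xi> where \<xi>: "0 < \<xi>" "\<xi> < T"
      "E T - E 0 = T * ((h (v \<xi>) - h (u \<xi>)) / (v \<xi> - u \<xi>) - h' (u \<xi>))"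
      using mvt[OF T E_cont, of "\<lambda>t s. s * ((h (v t) - h (u t)) / (v t - u t) - h' (u t))"]
        E_der by (auto simp: has_field_derivative_def mult.commute[of _ "_ - _"])
    have in_B: "u \<xi> \<in> {0..B}" "v \<xi> \<in> {0..B}"
      using bound[of x \<xi>] bound[of y \<xi>] x y \<xi> by (auto simp: u_def v_def)
    obtain p where p: "p \<in> closed_segment (u \<xi>) (v \<xi>)"
      "h (v \<xi>) - h (u \<xi>) = h' p * (v \<xi> - u \<xi>)"
    proof -
      have "\<exists>p\<in>{a..b}. h b - h a = h' p * (b - a)" if "0 \<le> a" "a \<le> b" for a b
        using that by (intro mvt_very_simple[of a b h "\<lambda>p s. h' p * s", simplified])
          (auto intro!: has_field_derivative_imp_has_derivative DERIV_subset[OF h_deriv])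
      from this[of "u \<xi>" "v \<xi>"] this[of "v \<xi>" "u \<xi>"] in_B that show ?thesis
        by (cases "u \<xi> \<le> v \<xi>") (auto simp: closed_segment_eq_real_ivl algebra_simps)
    qed
    have p_B: "p \<in> {0..B}" and p_dist: "\<bar>p - u \<xi>\<bar> \<le> \<bar>v \<xi> - u \<xi>\<bar>"
      using p(1) in_B by (auto simp: closed_segment_eq_real_ivl split: if_splits)
    have "\<bar>E T - E 0\<bar> = T * \<bar>h' p - h' (u \<xi>)\<bar>"
      using \<xi> p(2) vu[of \<xi>] T by (simp add: abs_mult)
    also have "\<dots> \<le> T * (M * \<bar>v \<xi> - u \<xi>\<bar>)"
      using M p_B in_B T p_dist
      by (intro mult_left_mono order_trans[OF bspec[OF bspec[OF M(2)]]]) auto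
    also have "\<dots> \<le> T * (M * (exp (K * T) * \<bar>y - x\<bar>))"
    proof -
      have "\<bar>v \<xi> - u \<xi>\<bar> \<le> exp (K * \<xi>) * \<bar>y - x\<bar>"
        using K(2)[OF u v, of \<xi>] \<xi> y by (auto simp: u0 v0)
      also have "\<dots> \<le> exp (K * T) * \<bar>y - x\<bar>"
        using \<xi> K(1) by (intro mult_right_mono) (auto intro: mult_left_mono)
      finally show ?thesis
        using T M(1) by (intro mult_left_mono) auto
    qed
    finally have "\<bar>E T - E 0\<bar> \<le> c * \<bar>y - x\<bar>"
      by (simp add: c_def mult_ac)
    moreover have "E 0 = 0"
      using y(3) by (simp add: E_def D_def u0 v0 A0)
    moreover have "D T = q y"
      by (simp add: D_def q_def u_def v_def)
    ultimately show ?thesis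
      using D_pos[of T] T by (simp add: E_def)
  qed
  have near: "\<forall>\<^sub>F y in at x. 0 \<le> y \<and> y \<le> x + 1 \<and> y \<noteq> x"
  proof -
    have "\<forall>\<^sub>F y in at x. y \<in> {0<..<x + 1} - {x}"
      using x by (intro eventually_at_in_open) auto
    then show ?thesis
      by (rule eventually_mono) auto
  qed
  have "((\<lambda>y. ln (q y) - A T) \<longlongrightarrow> 0) (at x)"
  proof (rule Lim_null_comparison)
    show "\<forall>\<^sub>F y in at x. norm (ln (q y) - A T) \<le> c * \<bar>y - x\<bar>"
      using near by (rule eventually_mono) (use main in auto)
    show "((\<lambda>y. c * \<bar>y - x\<bar>) \<longlongrightarrow> 0) (at x)"
      by (rule tendsto_eq_intros refl | simp)+
  qed
  then have "((\<lambda>y. exp ((ln (q y) - A T) + A T)) \<longlongrightarrow> exp (0 + A T)) (at x)"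
    by (intro tendsto_intros)
  moreover have "\<forall>\<^sub>F y in at x. exp ((ln (q y) - A T) + A T) = q y"
    using near by (rule eventually_mono) (use main in auto)
  ultimately have "(q \<longlongrightarrow> exp (0 + A T)) (at x)"
    by (rule Lim_transform_eventually)
  then show ?thesis
    unfolding q_def has_field_derivative_iff by blast
qed

end

section \<open>The impulsive flow and its stroboscopic map\<close>

lemma solution_on_cong:
  assumes u: "solution_on h T u" and eq: "\<And>t. t \<in> {0..T} \<Longrightarrow> u t = v t"
  shows "solution_on h T v"
proof -
  have "(v has_real_derivative h (v t)) (at t)" if t: "t \<in> {0<..<T}" for t
  proof (rule has_field_derivative_transform_within_open[where S = "{0<..<T}"])
    show "(u has_real_derivative h (v t)) (at t)"
      using solution_onD(3)[OF u, of t] t eq[of t] by simp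
  qed (use t eq in auto)
  moreover have "continuous_on {0..T} v"
    using solution_onD(1)[OF u] eq by (rule continuous_on_eq)
  moreover have "0 \<le> v t" if "t \<in> {0..T}" for t
    using solution_onD(2)[OF u, of t] eq[OF that] that by simp
  ultimately show ?thesis
    by (simp add: solution_on_def)
qed

text \<open>One period of an impulsive solution, with the value at the next pulse replaced by the left
  limit, is a solution of the unperturbed equation.\<close>

lemma impulsive_solution_period:
  assumes f: "impulsive_solution h \<omega> lam x f" and \<omega>: "\<omega> > 0"
  obtains u where "solution_on h \<omega> u" "\<And>s. 0 \<le> s \<Longrightarrow> s < \<omega> \<Longrightarrow> u s = f (real k * \<omega> + s)"
    "f (real (Suc k) * \<omega>) = (1 + lam) * u \<omega>"
proof -
  define a b where "a = real k * \<omega>" and "b = real (Suc k) * \<omega>"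
  have ab: "0 \<le> a" "a < b" "b = a + \<omega>"
    using \<omega> by (auto simp: a_def b_def algebra_simps)
  have nonneg: "f t \<ge> 0" if "t \<ge> 0" for t
    using f that by (auto simp: impulsive_solution_def)
  have der: "(f has_real_derivative h (f t)) (at t within {a..<b})" if "t \<in> {a..<b}" for t
  proof -
    have "\<forall>k::nat. \<forall>t\<in>{real k * \<omega>..<real (k + 1) * \<omega>}.
        (f has_real_derivative h (f t)) (at t within {real k * \<omega>..<real (k + 1) * \<omega>})"
      using f unfolding impulsive_solution_def by (elim conjE)
    then show ?thesis
      using that unfolding a_def b_def Suc_eq_plus1 by (elim allE[of _ k] bspec)
  qed
  have "\<forall>k::nat. k \<ge> 1 \<longrightarrow>
      (\<exists>L. (f \<longlongrightarrow> L) (at_left (real k * \<omega>)) \<and> f (real k * \<omega>) = (1 + lam) * L)"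
    using f unfolding impulsive_solution_def by (elim conjE)
  from this[rule_format, of "Suc k"]
  obtain L where L: "(f \<longlongrightarrow> L) (at_left b)" "f b = (1 + lam) * L"
    unfolding b_def by auto
  have "\<forall>\<^sub>F t in at_left b. f t \<ge> 0"
    using ab nonneg
    by (intro eventually_mono[OF eventually_at_left_real[OF ab(2)]]) auto
  then have L_nonneg: "L \<ge> 0"
    using L(1) by (intro tendsto_lowerbound) auto
  define w where "w t = (if t < b then f t else L)" for t
  have w_lim: "(w \<longlongrightarrow> l) F" if "(f \<longlongrightarrow> l) F" "\<forall>\<^sub>F t in F. t < b" for l F
  proof -
    have "\<forall>\<^sub>F t in F. f t = w t"
      using that(2) by (rule eventually_mono) (simp add: w_def)
    then show ?thesis
      using that(1) by (metis Lim_transform_eventually)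
  qed
  have f_lim: "(f \<longlongrightarrow> f t) (at t within {a..<b})" if "t \<in> {a..<b}" for t
    using DERIV_continuous[OF der[OF that]] by (simp add: continuous_within)
  have at_t: "at t within {a..<b} = at t" if "a < t" "t < b" for t
    using that by (intro at_within_interior) simp
  have at_a: "at a within {a..<b} = at_right a"
    using ab(2) by (intro at_within_nhd[of _ "{..<b}"]) auto
  have w_cont: "continuous_on {a..b} w"
  proof (rule continuous_on_IccI)
    show "(w \<longlongrightarrow> w a) (at_right a)"
      using w_lim[of "f a" "at_right a"] f_lim[of a] ab at_a
        eventually_mono[OF eventually_at_right_real[OF ab(2)], of "\<lambda>t. t < b"]
      by (simp add: w_def)
    show "(w \<longlongrightarrow> w b) (at_left b)"
      using w_lim[OF L(1)] by (auto simp: w_def eventually_at_filter)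
    show "w \<midarrow>t\<rightarrow> w t" if "a < t" "t < b" for t
    proof -
      have "\<forall>\<^sub>F s in at t. s < b"
        using that(2) by (auto intro: order_tendstoD(2)[OF tendsto_ident_at])
      then show ?thesis
        using w_lim f_lim[of t] at_t[OF that] that by (auto simp: w_def)
    qed
  qed (fact ab(2))
  have w_der: "(w has_real_derivative h (w t)) (at t)" if t: "a < t" "t < b" for t
  proof (rule has_field_derivative_transform_within_open[where S = "{a<..<b}"])
    show "(f has_real_derivative h (w t)) (at t)"
      using der[of t] at_t[OF t] t by (simp add: w_def)
  qed (use t in \<open>auto simp: w_def\<close>)
  define u where "u s = w (a + s)" for s
  have "solution_on h \<omega> u"
    unfolding solution_on_def
  proof (intro conjI ballI)
    show "continuous_on {0..\<omega>} u"
      unfolding u_def by (rule continuous_on_compose2[OF w_cont]) (use ab in \<open>auto intro!: continuous_intros\<close>)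
    show "0 \<le> u s" if "s \<in> {0..\<omega>}" for s
      using that nonneg[of "a + s"] ab L_nonneg by (auto simp: u_def w_def)
    show "(u has_real_derivative h (u s)) (at s)" if "s \<in> {0<..<\<omega>}" for s
      using w_der[of "s + a"] that ab unfolding u_def add.commute[of a] DERIV_shift by simp
  qed
  moreover have "u s = f (real k * \<omega> + s)" if "0 \<le> s" "s < \<omega>" for s
    using that ab by (simp add: u_def w_def a_def)
  moreover have "f (real (Suc k) * \<omega>) = (1 + lam) * u \<omega>"
    using L(2) ab by (simp add: u_def w_def b_def)
  ultimately show ?thesis
    using that by blast
qed

text \<open>A field as above together with its impulsive flow \<open>phi\<close> for all \<open>\<lambda> > -1\<close>. The value
  \<open>\<lambda> = 0\<close> gives the unperturbed flow.\<close>

locale impulsive_field = halfline_field +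
  fixes \<omega> :: real and phi :: "real \<Rightarrow> real \<Rightarrow> real \<Rightarrow> real"
  assumes \<omega>_pos: "\<omega> > 0"
    and flow: "impulsive_flow h \<omega> phi"
begin

abbreviation R :: "real \<Rightarrow> real" where
  "R \<equiv> phi 0 \<omega>"

lemma phi_impulsive: "lam > -1 \<Longrightarrow> x \<ge> 0 \<Longrightarrow> impulsive_solution h \<omega> lam x (\<lambda>t. phi lam t x)"
  using flow by (auto simp: impulsive_flow_def)

lemma phi_0: "lam > -1 \<Longrightarrow> x \<ge> 0 \<Longrightarrow> phi lam 0 x = x"
  and phi_nonneg: "lam > -1 \<Longrightarrow> x \<ge> 0 \<Longrightarrow> t \<ge> 0 \<Longrightarrow> phi lam t x \<ge> 0"
  using phi_impulsive by (auto simp: impulsive_solution_def)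

lemma unperturbed_solution:
  assumes "x \<ge> 0"
  shows "solution_on h \<omega> (\<lambda>t. phi 0 t x)"
proof -
  obtain u where u: "solution_on h \<omega> u"
    "\<And>s. 0 \<le> s \<Longrightarrow> s < \<omega> \<Longrightarrow> u s = phi 0 (real 0 * \<omega> + s) x"
    "phi 0 (real (Suc 0) * \<omega>) x = (1 + 0) * u \<omega>"
    using impulsive_solution_period[OF phi_impulsive[OF _ assms] \<omega>_pos, of 0 0] by auto
  have "u s = phi 0 s x" if "s \<in> {0..\<omega>}" for s
    using u(2)[of s] u(3) that by (cases "s = \<omega>") auto
  with u(1) show ?thesis
    by (rule solution_on_cong)
qed

text \<open>Uniqueness for the unperturbed equation expresses the impulsive flow on each period by the
  unperturbed one, and its values at successive pulses as iterates of \<open>(1 + \<lambda>) R\<close>.\<close>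

lemma phi_period:
  assumes lam: "lam > -1" and x: "x \<ge> 0"
  shows phi_between_pulses:
      "0 \<le> s \<Longrightarrow> s < \<omega> \<Longrightarrow> phi lam (real k * \<omega> + s) x = phi 0 s (phi lam (real k * \<omega>) x)"
    and phi_next_pulse:
      "phi lam (real (Suc k) * \<omega>) x = (1 + lam) * R (phi lam (real k * \<omega>) x)"
proof -
  define y where "y = phi lam (real k * \<omega>) x"
  have y: "y \<ge> 0"
    unfolding y_def using phi_nonneg[OF lam x] \<omega>_pos by simp
  obtain u where u: "solution_on h \<omega> u"
    "\<And>s. 0 \<le> s \<Longrightarrow> s < \<omega> \<Longrightarrow> u s = phi lam (real k * \<omega> + s) x"
    "phi lam (real (Suc k) * \<omega>) x = (1 + lam) * u \<omega>"
    using impulsive_solution_period[OF phi_impulsive[OF lam x] \<omega>_pos, of k] by auto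
  have "u 0 = y"
    using u(2)[of 0] \<omega>_pos by (simp add: y_def)
  then have same: "u s = phi 0 s y" if "0 \<le> s" "s \<le> \<omega>" for s
    using solution_meets_iff[OF u(1) unperturbed_solution[OF y] that] phi_0[of 0 y] y by simp
  show "phi lam (real k * \<omega> + s) x = phi 0 s (phi lam (real k * \<omega>) x)" if "0 \<le> s" "s < \<omega>"
    using u(2)[OF that] same[of s] that by (simp add: y_def)
  show "phi lam (real (Suc k) * \<omega>) x = (1 + lam) * R (phi lam (real k * \<omega>) x)"
    using u(3) same[of \<omega>] \<omega>_pos by (simp add: y_def)
qed

lemma split_time:
  assumes "t \<ge> 0"
  obtains k :: nat and s where "0 \<le> s" "s < \<omega>" "t = real k * \<omega> + s"
proof -
  define k where "k = nat \<lfloor>t / \<omega>\<rfloor>"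
  have "real k = of_int \<lfloor>t / \<omega>\<rfloor>"
    using assms \<omega>_pos by (simp add: k_def)
  then have "real k \<le> t / \<omega>" "t / \<omega> < real k + 1"
    by linarith+
  then show ?thesis
    using \<omega>_pos by (intro that[of "t - real k * \<omega>" k]) (auto simp: field_simps)
qed

lemma periodic_iff_fixed_point:
  assumes lam: "lam > -1" and x: "x \<ge> 0"
  shows "is_periodic \<omega> (\<lambda>t. phi lam t x) \<longleftrightarrow> (1 + lam) * R x = x"
proof
  assume "is_periodic \<omega> (\<lambda>t. phi lam t x)"
  then have "phi lam (0 + \<omega>) x = phi lam 0 x"
    unfolding is_periodic_def by blast
  then show "(1 + lam) * R x = x"
    using phi_next_pulse[OF lam x, of 0] phi_0[OF lam x] by simp
next
  assume fixed: "(1 + lam) * R x = x"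
  have pulses: "phi lam (real k * \<omega>) x = x" for k
    using phi_0[OF lam x] phi_next_pulse[OF lam x] fixed by (induction k) auto
  show "is_periodic \<omega> (\<lambda>t. phi lam t x)"
    unfolding is_periodic_def
  proof (intro allI impI)
    fix t :: real assume "t \<ge> 0"
    then obtain k s where s: "0 \<le> s" "s < \<omega>" "t = real k * \<omega> + s"
      by (rule split_time)
    have "t + \<omega> = real (Suc k) * \<omega> + s"
      using s by (simp add: algebra_simps)
    then show "phi lam (t + \<omega>) x = phi lam t x"
      using phi_between_pulses[OF lam x s(1,2), of "Suc k"]
        phi_between_pulses[OF lam x s(1,2), of k] pulses s(3) by metis
  qed
qed

lemma periodic_orbit_eq:
  assumes lam: "lam > -1" and x: "x \<ge> 0" and fixed: "(1 + lam) * R x = x"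
  shows "(\<lambda>t. phi lam t x) ` {0..} = (\<lambda>s. phi 0 s x) ` {0..<\<omega>}"
proof -
  have pulses: "phi lam (real k * \<omega>) x = x" for k
    using phi_0[OF lam x] phi_next_pulse[OF lam x] fixed by (induction k) auto
  have "phi lam t x \<in> (\<lambda>s. phi 0 s x) ` {0..<\<omega>}" if t: "t \<ge> 0" for t
  proof -
    obtain k s where "0 \<le> s" "s < \<omega>" "t = real k * \<omega> + s"
      using t by (rule split_time)
    then show ?thesis
      using phi_between_pulses[OF lam x, of s k] pulses by auto
  qed
  moreover have "phi 0 s x \<in> (\<lambda>t. phi lam t x) ` {0..}" if "0 \<le> s" "s < \<omega>" for s
    using phi_between_pulses[OF lam x that, of 0] pulses[of 0] that
    by (intro image_eqI[of _ _ s]) auto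
  ultimately show ?thesis
    by auto
qed

subsection \<open>The time-\<open>\<omega>\<close> map of the unperturbed problem\<close>

lemma R_zero: "R 0 = 0"
  using solution_stationary[OF unperturbed_solution[of 0], of \<omega>] phi_0[of 0 0] h0 \<omega>_pos by simp

lemma R_less: "0 \<le> x \<Longrightarrow> x < y \<Longrightarrow> R x < R y"
  using solution_order[OF unperturbed_solution[of x] unperturbed_solution[of y], of \<omega>]
    phi_0[of 0] \<omega>_pos by simp

lemma R_pos: "x > 0 \<Longrightarrow> R x > 0"
  using R_less[of 0 x] R_zero by simp

lemma R_le: "x \<ge> 0 \<Longrightarrow> R x \<le> exp (C * \<omega>) * x"
  using solution_bound[OF unperturbed_solution[of x], of \<omega>] phi_0[of 0] \<omega>_pos by simp

lemma R_differentiable: "x > 0 \<Longrightarrow> \<exists>r. (R has_real_derivative r) (at x)"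
  by (intro differentiable_in_initial_value conjI unperturbed_solution phi_0 \<omega>_pos) simp_all

lemma R_cont: "a > 0 \<Longrightarrow> continuous_on {a..b} R"
  by (intro continuous_at_imp_continuous_on ballI) (metis DERIV_isCont R_differentiable atLeastAtMost_iff less_le_trans)

section \<open>Counting periodic orbits\<close>

text \<open>The initial points of the periodic solutions for \<open>\<lambda>\<close>, as fixed points of the stroboscopic
  map.\<close>

definition fixed_points :: "real \<Rightarrow> real set" where
  "fixed_points lam = {x. 0 \<le> x \<and> (1 + lam) * R x = x}"

text \<open>A fixed point can be recovered from its orbit: for \<open>\<lambda> \<ge> 0\<close> it satisfies \<open>R z \<le> z\<close>, so the
  solution between pulses is nonincreasing and \<open>z\<close> is the largest point of the orbit; for
  \<open>\<lambda> \<le> 0\<close> it is the smallest.\<close>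

lemma periodic_orbits_eqpoll_fixed_points:
  assumes lam: "lam > -1"
  shows "periodic_orbits \<omega> (phi lam) \<approx> fixed_points lam"
proof -
  define orbit where "orbit = (\<lambda>x. (\<lambda>t. phi lam t x) ` {0..})"
  have "fixed_points lam = {x. 0 \<le> x \<and> is_periodic \<omega> (\<lambda>t. phi lam t x)}"
    unfolding fixed_points_def using periodic_iff_fixed_point[OF lam] by blast
  then have "periodic_orbits \<omega> (phi lam) = orbit ` fixed_points lam"
    unfolding periodic_orbits_def orbit_def by (simp only: Setcompr_eq_image[symmetric] mem_Collect_eq)
  moreover have "inj_on orbit (fixed_points lam)"
  proof (rule inj_onI)
    fix x y assume x: "x \<in> fixed_points lam" and y: "y \<in> fixed_points lam"
      and eq: "orbit x = orbit y"
    have self: "z \<in> orbit z" if "z \<in> fixed_points lam" for z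
      unfolding orbit_def
      by (rule image_eqI[of _ _ 0]) (use phi_0[OF lam] that in \<open>auto simp: fixed_points_def\<close>)
    have orbitE: "\<exists>s. 0 \<le> s \<and> s < \<omega> \<and> w = phi 0 s z"
      if "z \<in> fixed_points lam" "w \<in> orbit z" for z w
      using periodic_orbit_eq[OF lam, of z] that by (auto simp: fixed_points_def orbit_def)
    have largest: "w \<le> z" if z: "z \<in> fixed_points lam" "w \<in> orbit z" and "lam \<ge> 0" for w z
    proof -
      have z0: "z \<ge> 0" and fixed: "R z + lam * R z = z"
        using z(1) by (auto simp: fixed_points_def algebra_simps)
      have "0 \<le> lam * R z"
        using \<open>lam \<ge> 0\<close> phi_nonneg[of 0 z \<omega>] \<omega>_pos z0 by simp
      then have "R z \<le> phi 0 0 z"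
        using fixed phi_0[of 0 z] z0 by simp
      then show ?thesis
        using orbitE[OF z] solution_stays_below[OF unperturbed_solution[OF z0] \<omega>_pos]
          phi_0[of 0 z] z0 by fastforce
    qed
    have smallest: "z \<le> w" if z: "z \<in> fixed_points lam" "w \<in> orbit z" and "lam \<le> 0" for w z
    proof -
      have z0: "z \<ge> 0" and fixed: "R z + lam * R z = z"
        using z(1) by (auto simp: fixed_points_def algebra_simps)
      have "lam * R z \<le> 0"
        using \<open>lam \<le> 0\<close> phi_nonneg[of 0 z \<omega>] \<omega>_pos z0 by (intro mult_nonpos_nonneg) auto
      then have "phi 0 0 z \<le> R z"
        using fixed phi_0[of 0 z] z0 by simp
      then show ?thesis
        using orbitE[OF z] solution_stays_above[OF unperturbed_solution[OF z0] \<omega>_pos]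
          phi_0[of 0 z] z0 by fastforce
    qed
    have "x \<in> orbit y" "y \<in> orbit x"
      using self[OF x] self[OF y] eq by auto
    then show "x = y"
      using largest[OF x, of y] largest[OF y, of x] smallest[OF x, of y] smallest[OF y, of x]
      by (cases "lam \<ge> 0") auto
  qed
  ultimately show ?thesis
    by (simp add: inj_on_image_eqpoll_self)
qed

lemma fixed_points_eqpoll_intersection:
  assumes lam: "lam > -1"
  shows "fixed_points lam \<approx> graph_halfline R \<inter> graph_halfline (\<lambda>x. x / (lam + 1))"
proof -
  have "R x = x / (lam + 1) \<longleftrightarrow> (1 + lam) * R x = x" for x
    using lam by (auto simp: field_simps)
  then have "graph_halfline R \<inter> graph_halfline (\<lambda>x. x / (lam + 1)) = (\<lambda>x. (x, R x)) ` fixed_points lam"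
    by (auto simp: graph_halfline_def fixed_points_def image_iff)
  moreover have "inj_on (\<lambda>x. (x, R x)) (fixed_points lam)"
    by (auto intro: inj_onI)
  ultimately show ?thesis
    using eqpoll_sym[OF inj_on_image_eqpoll_self] by simp
qed

lemma number_of_orbits_varies:
  "\<exists>lam1>-1. \<exists>lam2>-1. \<not> periodic_orbits \<omega> (phi lam1) \<approx> periodic_orbits \<omega> (phi lam2)"
proof -
  \<comment> \<open>With this parameter, the stroboscopic map at least halves every value.\<close>
  define lam1 where "lam1 = exp (- (C * \<omega>)) / 2 - 1"
  define lam2 where "lam2 = 1 / R 1 - 1"
  have gt: "lam1 > -1" "lam2 > -1"
    using R_pos[of 1] by (auto simp: lam1_def lam2_def)
  have "(1 + lam1) * R x \<noteq> x" if "x > 0" for x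
  proof -
    have "(1 + lam1) * R x \<le> (1 + lam1) * (exp (C * \<omega>) * x)"
      using R_le[of x] that gt by (intro mult_left_mono) auto
    also have "\<dots> = x / 2"
      by (simp add: lam1_def exp_minus)
    finally show ?thesis
      using that by auto
  qed
  then have "x \<le> 0" if "x \<in> fixed_points lam1" for x
    using that unfolding fixed_points_def by (metis (mono_tags, lifting) mem_Collect_eq not_le)
  moreover have "x \<ge> 0" if "x \<in> fixed_points lam1" for x
    using that by (simp add: fixed_points_def)
  moreover have "0 \<in> fixed_points lam1"
    by (simp add: fixed_points_def R_zero)
  ultimately have one: "fixed_points lam1 = {0}"
    by (intro equalityI subsetI) (auto intro: antisym)
  have two: "{0, 1} \<subseteq> fixed_points lam2"
    using R_zero R_pos[of 1] by (auto simp: fixed_points_def lam2_def)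
  have "\<not> periodic_orbits \<omega> (phi lam1) \<approx> periodic_orbits \<omega> (phi lam2)"
  proof
    assume "periodic_orbits \<omega> (phi lam1) \<approx> periodic_orbits \<omega> (phi lam2)"
    from eqpoll_trans[OF this periodic_orbits_eqpoll_fixed_points[OF gt(2)]]
    have "fixed_points lam1 \<approx> fixed_points lam2"
      by (rule eqpoll_trans[OF eqpoll_sym[OF periodic_orbits_eqpoll_fixed_points[OF gt(1)]]])
    then obtain f where "bij_betw f (fixed_points lam1) (fixed_points lam2)"
      by (auto simp: eqpoll_def)
    then have "fixed_points lam2 = {f 0}"
      by (simp add: one bij_betw_def)
    then have "card (fixed_points lam2) = 1"
      by simp
    then have "card {0, 1 :: real} \<le> 1"
      using card_mono[OF _ two] by (metis card.infinite zero_neq_one)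
    then show False
      by simp
  qed
  with gt show ?thesis
    by (intro exI conjI)
qed

section \<open>Stability of periodic solutions\<close>

text \<open>The parameter for which the solution starting at \<open>x > 0\<close> is periodic.\<close>

definition g :: "real \<Rightarrow> real" where
  "g x = x / R x - 1"

lemma g_gt: "x > 0 \<Longrightarrow> g x > -1"
  using R_pos by (simp add: g_def)

lemma fixed_point_iff_g: "x > 0 \<Longrightarrow> (1 + lam) * R x = x \<longleftrightarrow> lam = g x"
  and map_less_iff_g: "x > 0 \<Longrightarrow> (1 + lam) * R x < x \<longleftrightarrow> lam < g x"
  and map_greater_iff_g: "x > 0 \<Longrightarrow> x < (1 + lam) * R x \<longleftrightarrow> g x < lam"
  using R_pos[of x] by (auto simp: g_def field_simps)

text \<open>Since \<open>deriv\<close> is an arbitrary value where no derivative exists, its sign carries information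
  only because \<open>g\<close> is differentiable.\<close>

lemma g_has_derivative:
  assumes "x > 0"
  shows "(g has_real_derivative deriv g x) (at x)"
proof -
  obtain r where "(R has_real_derivative r) (at x)"
    using R_differentiable[OF assms] by blast
  then have "(g has_real_derivative (1 * R x - x * r) / (R x * R x) - 0) (at x)"
    unfolding g_def using R_pos[OF assms]
    by (intro DERIV_diff DERIV_divide DERIV_ident DERIV_const) auto
  then show ?thesis
    by (metis DERIV_imp_deriv)
qed

lemma stroboscopic_map:
  assumes "lam > -1" "y \<ge> 0"
  shows "phi lam (real 0 * \<omega>) y = y"
    and "phi lam (real (Suc k) * \<omega>) y = (1 + lam) * R (phi lam (real k * \<omega>) y)"
  using phi_0 phi_next_pulse assms by auto

lemma stroboscopic_cont: "a > 0 \<Longrightarrow> continuous_on {a..b} (\<lambda>x. (1 + lam) * R x)"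
  by (intro continuous_intros R_cont)

lemma asymptotically_stable_of_deriv_pos:
  assumes lam: "lam > -1" and x0: "x0 > 0" and fixed: "(1 + lam) * R x0 = x0"
    and pos: "deriv g x0 > 0"
  shows "asymptotically_stable_solution \<omega> (phi lam) x0"
proof -
  define z where "z y k = phi lam (real k * \<omega>) y" for y k
  have lam_g: "lam = g x0"
    using fixed_point_iff_g[OF x0] fixed by simp
  obtain d1 where d1: "d1 > 0" "\<And>e. 0 < e \<Longrightarrow> e < d1 \<Longrightarrow> g x0 < g (x0 + e)"
    using DERIV_pos_inc_right[OF g_has_derivative[OF x0] pos] by blast
  obtain d2 where d2: "d2 > 0" "\<And>e. 0 < e \<Longrightarrow> e < d2 \<Longrightarrow> g (x0 - e) < g x0"
    using DERIV_pos_inc_left[OF g_has_derivative[OF x0] pos] by blast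
  \<comment> \<open>Inside \<open>d1\<close> and \<open>d2\<close> the map moves points towards \<open>x0\<close>; being increasing, it does not
    carry them across.\<close>
  have attract: "z y \<longlonglongrightarrow> x0 \<and> (\<forall>k. \<bar>z y k - x0\<bar> \<le> \<bar>y - x0\<bar>)"
    if d: "0 < d" "d < x0" "d < d1" "d < d2" and y: "y \<in> {x0 - d..x0 + d}" for d y
  proof -
    have y0: "y \<ge> 0"
      using d y by auto
    have "z y \<longlonglongrightarrow> x0 \<and> (\<forall>k. \<bar>z y k - x0\<bar> \<le> \<bar>z y 0 - x0\<bar>)"
    proof (rule monotone_map_attracts[where P = "\<lambda>x. (1 + lam) * R x"])
      show "mono_on {x0 - d..x0 + d} (\<lambda>x. (1 + lam) * R x)"
      proof (rule mono_onI)
        fix p q assume "p \<in> {x0 - d..x0 + d}" "q \<in> {x0 - d..x0 + d}" "p \<le> q"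
        then show "(1 + lam) * R p \<le> (1 + lam) * R q"
          using R_less[of p q] d lam by (cases "p = q") auto
      qed
      show "continuous_on {x0 - d..x0 + d} (\<lambda>x. (1 + lam) * R x)"
        using d by (intro stroboscopic_cont) auto
      show "(1 + lam) * R x < x" if "x0 < x" "x \<le> x0 + d" for x
        using d1(2)[of "x - x0"] that d x0 by (subst map_less_iff_g) (auto simp: lam_g)
      show "x < (1 + lam) * R x" if "x0 - d \<le> x" "x < x0" for x
        using d2(2)[of "x0 - x"] that d x0 by (subst map_greater_iff_g) (auto simp: lam_g)
      show "z y 0 \<in> {x0 - d..x0 + d}" "\<And>k. z y (Suc k) = (1 + lam) * R (z y k)"
        using stroboscopic_map[OF lam y0] y unfolding z_def by auto
    qed (use d fixed in auto)
    then show ?thesis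
      using stroboscopic_map(1)[OF lam y0] by (simp add: z_def)
  qed
  have "stable_solution \<omega> (phi lam) x0"
    unfolding stable_solution_def
  proof (intro allI impI)
    fix V assume "neighbourhood x0 V"
    then obtain e where e: "0 < e" "e < x0" "{x0 - e..x0 + e} \<subseteq> V"
      using neighbourhood_contains_interval x0 by blast
    define d where "d = min e (min d1 d2) / 2"
    have d: "0 < d" "d < x0" "d < d1" "d < d2" "d < e"
      using e d1(1) d2(1) by (auto simp: d_def)
    define W where "W = {x0 - d<..<x0 + d}"
    have "neighbourhood x0 W"
      unfolding W_def using d by (intro neighbourhood_interval) auto
    moreover have "W \<subseteq> V"
      using e d by (auto simp: W_def)
    moreover have "phi lam (real k * \<omega>) y \<in> V" if "y \<in> W" for y k
    proof -
      have "\<bar>z y k - x0\<bar> \<le> \<bar>y - x0\<bar>"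
        using attract[OF d(1-4), of y] that by (auto simp: W_def)
      then have "z y k \<in> {x0 - e..x0 + e}"
        using that d by (auto simp: W_def)
      then show ?thesis
        using e by (auto simp: z_def)
    qed
    ultimately show "\<exists>W. neighbourhood x0 W \<and> W \<subseteq> V \<and>
        (\<forall>y\<in>W. \<forall>k\<ge>1. phi lam (real k * \<omega>) y \<in> V)"
      by blast
  qed
  moreover have "\<exists>V. neighbourhood x0 V \<and> (\<forall>y\<in>V. (\<lambda>k. phi lam (real k * \<omega>) y) \<longlonglongrightarrow> x0)"
  proof -
    define d where "d = min x0 (min d1 d2) / 2"
    have d: "0 < d" "d < x0" "d < d1" "d < d2"
      using x0 d1(1) d2(1) by (auto simp: d_def)
    have "z y \<longlonglongrightarrow> x0" if "y \<in> {x0 - d<..<x0 + d}" for y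
      using attract[OF d, of y] that by auto
    then show ?thesis
      using d unfolding z_def
      by (intro exI[of _ "{x0 - d<..<x0 + d}"] conjI neighbourhood_interval ballI) auto
  qed
  ultimately show ?thesis
    by (simp add: asymptotically_stable_solution_def)
qed

text \<open>To the right of \<open>x0\<close>, within distance \<open>d1\<close>, every point is moved to the right. An orbit that
  starts there and stays within the smaller distance \<open>d\<close> would converge to a fixed point other
  than \<open>x0\<close>, and there is none.\<close>

lemma unstable_of_deriv_neg:
  assumes lam: "lam > -1" and x0: "x0 > 0" and fixed: "(1 + lam) * R x0 = x0"
    and neg: "deriv g x0 < 0"
  shows "unstable_solution \<omega> (phi lam) x0"
  unfolding unstable_solution_def
proof
  assume stable: "stable_solution \<omega> (phi lam) x0"
  have lam_g: "lam = g x0"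
    using fixed_point_iff_g[OF x0] fixed by simp
  obtain d1 where d1: "d1 > 0" "\<And>e. 0 < e \<Longrightarrow> e < d1 \<Longrightarrow> g (x0 + e) < g x0"
    using DERIV_neg_dec_right[OF g_has_derivative[OF x0] neg] by blast
  have up: "x < (1 + lam) * R x" if "x0 < x" "x < x0 + d1" for x
    using d1(2)[of "x - x0"] that x0 by (subst map_greater_iff_g) (auto simp: lam_g)
  define d where "d = min x0 d1 / 2"
  have d: "0 < d" "d < x0" "d < d1"
    using x0 d1(1) by (auto simp: d_def)
  have "neighbourhood x0 {x0 - d<..<x0 + d}"
    using d by (intro neighbourhood_interval) auto
  then obtain W where W: "neighbourhood x0 W" "W \<subseteq> {x0 - d<..<x0 + d}"
    "\<And>y k. y \<in> W \<Longrightarrow> k \<ge> 1 \<Longrightarrow> phi lam (real k * \<omega>) y \<in> {x0 - d<..<x0 + d}"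
    using stable unfolding stable_solution_def by (metis (no_types))
  obtain e where e: "0 < e" "e < x0" "{x0 - e..x0 + e} \<subseteq> W"
    using neighbourhood_contains_interval[OF W(1) x0] by blast
  define y where "y = x0 + e"
  have y: "y \<in> W" "y > x0" "y \<ge> 0"
    using e x0 by (auto simp: y_def)
  define z where "z k = phi lam (real k * \<omega>) y" for k
  have z0: "z 0 = y" and step: "\<And>k. z (Suc k) = (1 + lam) * R (z k)"
    using stroboscopic_map[OF lam y(3)] unfolding z_def by auto
  have z_less: "z k < x0 + d" for k
    using W(2) W(3)[of y k] y z0 by (cases k) (auto simp: z_def)
  have z_ge: "y \<le> z k" for k
  proof (induction k)
    case (Suc k)
    then show ?case
      using up[of "z k"] z_less[of k] y d by (simp add: step)
  qed (simp add: z0)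
  have "z k \<le> z (Suc k)" for k
    using up[of "z k"] z_less[of k] z_ge[of k] y d by (simp add: step)
  then have "monoseq z"
    by (simp add: monoseq_Suc)
  moreover have "z k \<in> {y..x0 + d}" for k
    using z_ge[of k] z_less[of k] by auto
  moreover have "continuous_on {y..x0 + d} (\<lambda>x. (1 + lam) * R x)"
    using y x0 by (intro stroboscopic_cont) auto
  ultimately obtain l where "l \<in> {y..x0 + d}" "(1 + lam) * R l = l"
    using monotone_orbit_converges_to_fixed_point[of z y "x0 + d" "\<lambda>x. (1 + lam) * R x"] step
    by blast
  then show False
    using up[of l] y d by auto
qed

end
section \<open>The linear bound from the zeros of the field\<close>

text \<open>The last zero is stable, so \<open>h\<close> is negative immediately to its right and cannot change sign
  afterwards.\<close>

lemma negative_beyond_last_zero: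
  assumes P1: "P1 h h' h''" and P2: "P2 h h' n Xs Xu" and y: "y > Xs n"
  shows "h y < 0"
proof (rule ccontr)
  assume "\<not> h y < 0"
  have n: "1 \<le> n" and zeros: "{x. 0 \<le> x \<and> h x = 0} = Xs ` {1..n} \<union> Xu ` {1..<n}"
    and order: "\<And>j. j \<in> {1..<n} \<Longrightarrow> Xs j < Xu j \<and> Xu j < Xs (j + 1)"
    and stable: "\<And>j. j \<in> {1..n} \<Longrightarrow> h' (Xs j) < 0"
    using P2 unfolding P2_def by blast+
  have der: "(h has_real_derivative h' x) (at x within {0..})" if "x \<ge> 0" for x
    using P1 that unfolding P1_def C2_halfline_def by blast
  have "Xs n \<in> {x. 0 \<le> x \<and> h x = 0}"
    unfolding zeros using n by auto
  then have Xn: "0 \<le> Xs n" "h (Xs n) = 0"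
    by auto
  have Xs_le: "j \<le> n \<longrightarrow> Xs i \<le> Xs j" if "1 \<le> i" "i \<le> j" for i j
    using that(2)
  proof (induction j rule: dec_induct)
    case (step j)
    then show ?case
      using order[of j] that(1) by fastforce
  qed simp
  have last: "x \<le> Xs n" if "0 \<le> x" "h x = 0" for x
  proof -
    have "x \<in> Xs ` {1..n} \<union> Xu ` {1..<n}"
      using that zeros by blast
    then show ?thesis
    proof
      assume "x \<in> Xs ` {1..n}"
      then show ?thesis
        using Xs_le by auto
    next
      assume "x \<in> Xu ` {1..<n}"
      then obtain j where j: "j \<in> {1..<n}" "x = Xu j"
        by blast
      then have "Xs (j + 1) \<le> Xs n"
        using Xs_le[of "j + 1" n] by auto
      then show ?thesis
        using order[OF j(1)] j(2) by auto
    qed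
  qed
  obtain d where d: "d > 0" "\<And>e. 0 < e \<Longrightarrow> Xs n + e \<in> {0..} \<Longrightarrow> e < d \<Longrightarrow> h (Xs n) > h (Xs n + e)"
    using has_real_derivative_neg_dec_right[OF der[OF Xn(1)]] stable[of n] n
    by (metis atLeastAtMost_iff order_refl)
  define z where "z = Xs n + min d (y - Xs n) / 2"
  have z: "Xs n < z" "z < y" "h z < 0"
    using d(1) y Xn d(2)[of "min d (y - Xs n) / 2"] by (auto simp: z_def min_def field_simps)
  have "continuous_on {z..y} h"
    using z Xn der by (intro continuous_on_subset[OF DERIV_continuous_on[OF der]]) auto
  then obtain x where "z \<le> x" "h x = 0"
    using IVT'[of h z 0 y] z \<open>\<not> h y < 0\<close> by auto
  then show False
    using last[of x] z Xn by auto
qed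

text \<open>A Lipschitz constant of \<open>h\<close> up to the last zero works, because \<open>h 0 = 0\<close> and \<open>h\<close> is
  negative further on.\<close>

lemma linear_bound_exists:
  assumes P1: "P1 h h' h''" and P2: "P2 h h' n Xs Xu"
  shows "\<exists>C. halfline_field h h' h'' C"
proof -
  have C2: "C2_halfline h h' h''"
    using P1 by (simp add: P1_def)
  have der: "\<And>x. x \<ge> 0 \<Longrightarrow> (h has_real_derivative h' x) (at x within {0..})"
    and der': "\<And>x. x \<ge> 0 \<Longrightarrow> (h' has_real_derivative h'' x) (at x within {0..})"
    using C2 by (auto simp: C2_halfline_def)
  have "0 \<in> {x. 0 \<le> x \<and> h x = 0}" and "1 \<le> n"
    using P2 unfolding P2_def by (auto intro!: image_eqI[of _ Xs 1])
  then have h0: "h 0 = 0"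
    by simp
  have "continuous_on {0..} h'"
    using der' by (auto intro: DERIV_continuous_on)
  then obtain C where C: "C \<ge> 0" "\<forall>x\<in>{0..Xs n}. \<forall>y\<in>{0..Xs n}. \<bar>h y - h x\<bar> \<le> C * \<bar>y - x\<bar>"
    using lipschitz_of_continuous_derivative[OF der, of "Xs n"] by blast
  have "h x \<le> C * x" if x: "x \<ge> 0" for x
  proof (cases "x \<le> Xs n")
    case True
    then have "\<bar>h x - h 0\<bar> \<le> C * \<bar>x - 0\<bar>"
      using x by (intro C(2)[rule_format]) auto
    then show ?thesis
      using x h0 by simp
  next
    case False
    then have "h x < 0"
      using negative_beyond_last_zero[OF P1 P2] by simp
    then show ?thesis
      using C(1) x mult_nonneg_nonneg[of C x] by linarith
  qed
  then have "halfline_field h h' h'' C"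
    using C2 h0 C(1) by unfold_locales
  then show ?thesis ..
qed

theorem theorem1:
  fixes h h' h'' :: "real \<Rightarrow> real"
    and \<omega> :: real
    and n :: nat
    and Xs Xu :: "nat \<Rightarrow> real"
    and phi :: "real \<Rightarrow> real \<Rightarrow> real \<Rightarrow> real"
    and R g :: "real \<Rightarrow> real"
  assumes "\<omega> > 0"
    and "P1 h h' h''"
    and "P2 h h' n Xs Xu"
    and "impulsive_flow h \<omega> phi"
    and R_def: "R = (\<lambda>x. phi 0 \<omega> x)"
    and g_def: "g = (\<lambda>x. x / R x - 1)"
    and "P4 R n Xs Xu"
    and "P5 R (h' 0) \<omega> n Xs"
  shows
    "((\<forall>lam>-1. periodic_orbits \<omega> (phi lam) \<approx>
                 graph_halfline R \<inter> graph_halfline (\<lambda>x. x / (lam + 1))) \<and>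
      (\<exists>lam1>-1. \<exists>lam2>-1.
         \<not> periodic_orbits \<omega> (phi lam1) \<approx> periodic_orbits \<omega> (phi lam2))) \<and>
     (\<forall>x>0. \<forall>lam>-1. is_periodic \<omega> (\<lambda>t. phi lam t x) \<longleftrightarrow> lam = g x) \<and>
     (\<forall>x0>0. \<exists>lam>-1. is_periodic \<omega> (\<lambda>t. phi lam t x0)) \<and>
     (\<forall>lam>-1. \<forall>x0>0. is_periodic \<omega> (\<lambda>t. phi lam t x0) \<longrightarrow>
        (deriv g x0 > 0 \<longrightarrow> asymptotically_stable_solution \<omega> (phi lam) x0) \<and>
        (deriv g x0 < 0 \<longrightarrow> unstable_solution \<omega> (phi lam) x0))"
proof -
  obtain C where "halfline_field h h' h'' C"
    using linear_bound_exists[OF assms(2,3)] by blast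
  then interpret I: impulsive_field h h' h'' C \<omega> phi
    using assms(1,4) by (simp add: impulsive_field_def impulsive_field_axioms_def)
  have R: "R = I.R"
    by (simp add: R_def)
  have g: "g = I.g"
    by (simp add: g_def R I.g_def fun_eq_iff)
  have count: "periodic_orbits \<omega> (phi lam) \<approx>
      graph_halfline R \<inter> graph_halfline (\<lambda>x. x / (lam + 1))" if "lam > -1" for lam
    unfolding R using I.periodic_orbits_eqpoll_fixed_points[OF that]
      I.fixed_points_eqpoll_intersection[OF that] by (rule eqpoll_trans)
  have periodic: "is_periodic \<omega> (\<lambda>t. phi lam t x) \<longleftrightarrow> lam = g x" if "x > 0" "lam > -1" for lam x
    unfolding g using I.periodic_iff_fixed_point[of lam x] I.fixed_point_iff_g[of x lam] that
    by simp
  have existence: "\<exists>lam>-1. is_periodic \<omega> (\<lambda>t. phi lam t x)" if "x > 0" for x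
    using periodic[OF that, of "g x"] I.g_gt[OF that] by (auto simp: g)
  have stability: "(deriv g x0 > 0 \<longrightarrow> asymptotically_stable_solution \<omega> (phi lam) x0) \<and>
      (deriv g x0 < 0 \<longrightarrow> unstable_solution \<omega> (phi lam) x0)"
    if "lam > -1" "x0 > 0" "is_periodic \<omega> (\<lambda>t. phi lam t x0)" for lam x0
    unfolding g using I.periodic_iff_fixed_point[of lam x0] that
      I.asymptotically_stable_of_deriv_pos[of lam x0] I.unstable_of_deriv_neg[of lam x0]
    by simp
  show ?thesis
    using count I.number_of_orbits_varies periodic existence stability by blast
qed

end
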